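(* Let $\mathcal G_4$ be the cycle of length $4$ and consider the edge reinforced random walk on $\mathcal G_4$ with reinforcement weight function $W:\mathbb N\to(0,\infty)$ and arbitrary initial edge weights $X_0^e\in\mathbb N$ and starting vertex $v_0$. If $W$ satisfies (H), i.e. $\sum_{k\in\mathbb N}\frac{1}{W(k)}<\infty$, then $\mathbb P(A)=1$, where $A:=\{\exists\, n:\ \{I_k,I_{k+1}\}=\{I_{k+1},I_{k+2}\}\text{ for all }k\ge n\}$ is the event that the walk eventually traverses only a single edge.
   Context: $\mathbb N=\{0,1,2,\ldots\}$. For $l\ge 3$, the cycle $\mathcal G_l$ has vertices $\{0,1,\ldots,l-1\}$ and edges $e_i=\{i,i+1\}$, $i=0,\ldots,l-1$, with addition modulo $l$. Edge reinforced random walk (ERRW) on a connected graph $\mathcal G$ of bounded degree: given a weight function $W:\mathbb N\to(0,\infty)$, initial edge weights $X_0^e\in\mathbb N$ with $\sup_e X_0^e<\infty$, and a starting vertex $I_0=v_0$, the process $(I_n)_{n\ge0}$ with natural filtration $(\mathcal F_n)$ jumps at each step to a neighbour of its current vertex with $\mathbb P(I_{n+1}=v'\mid\mathcal F_n)1_{\{I_n=v\}}=\frac{W(X_n^{\{v,v'\}})}{\sum_{w\sim v}W(X_n^{\{v,w\}})}1_{\{I_n=v\sim v'\}}$, where $X_n^e=X_0^e+\sum_{k=0}^{n-1}1_{\{\{I_k,I_{k+1}\}=e\}}$ is the current weight (initial weight plus number of traversals) of edge $e$. *)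

theory Defs
  imports "HOL-Probability.Probability"
begin

definition nbr4 :: "nat \<Rightarrow> nat \<Rightarrow> bool" where
  "nbr4 v w \<longleftrightarrow> v < 4 \<and> w < 4 \<and> (w = (v + 1) mod 4 \<or> v = (w + 1) mod 4)"

definition cur_weight :: "(nat set \<Rightarrow> nat) \<Rightarrow> (nat \<Rightarrow> nat) \<Rightarrow> nat \<Rightarrow> nat set \<Rightarrow> nat" where
  "cur_weight X0 vs n e = X0 e + card {k. k < n \<and> {vs k, vs (Suc k)} = e}"

definition errw_step :: "(nat \<Rightarrow> real) \<Rightarrow> (nat set \<Rightarrow> nat) \<Rightarrow> (nat \<Rightarrow> nat) \<Rightarrow> nat \<Rightarrow> real" where
  "errw_step W X0 vs n =
     (if nbr4 (vs n) (vs (Suc n))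
      then W (cur_weight X0 vs n {vs n, vs (Suc n)}) /
           (\<Sum>w\<in>{w. nbr4 (vs n) w}. W (cur_weight X0 vs n {vs n, w}))
      else 0)"

definition is_errw4 :: "'a measure \<Rightarrow> (nat \<Rightarrow> 'a \<Rightarrow> nat) \<Rightarrow> (nat \<Rightarrow> real) \<Rightarrow> (nat set \<Rightarrow> nat) \<Rightarrow> nat \<Rightarrow> bool" where
  "is_errw4 M I W X0 v0 \<longleftrightarrow>
     prob_space M \<and> (\<forall>n. I n \<in> measurable M (count_space UNIV)) \<and>
     (\<forall>n vs. measure M {\<omega> \<in> space M. \<forall>k\<le>n. I k \<omega> = vs k} =
        (if vs 0 = v0 then 1 else 0) * (\<Prod>k<n. errw_step W X0 vs k))"

end

theory Submission
  imports Defs "HOL-Real_Asymp.Real_Asymp"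
begin

text \<open>
  Colour the edges of the even cycle alternately by signs \<open>s e = \<plusminus>1\<close>. If a crossing of the edge \<open>e\<close> at
  weight \<open>x\<close> contributes the factor \<open>1 + \<i> s e \<theta> / W x\<close>, then the two possible factors at a vertex have mean \<open>1\<close>,
  so the product of the factors along the walk is a complex martingale. This remains true if only the
  steps selected by a predictable rule contribute. Let \<open>K\<close> be a fixed set containing all pairs \<open>(e, x)\<close> that can
  contribute, and divide by the product over \<open>K\<close>, which converges because \<open>\<Sum> 1 / W k < \<infinity>\<close>. The
  resulting martingale \<open>Z\<close> is bounded by \<open>1\<close>, since all factors have modulus at least \<open>1\<close>. Its limit is
  \<open>1\<close> where every pair in \<open>K\<close> is used, and elsewhere it vanishes as \<open>\<theta> \<rightarrow> \<infinity>\<close>, as does its initial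
  value. Hence almost surely some pair in \<open>K\<close> is never used.

  With all steps selected, this shows that some edge is crossed only finitely often. After its last crossing the
  walk lives on a path, where the crossings of each edge alternate in direction. Selecting only the
  steps from a fixed vertex therefore uses every second weight of the two incident edges, and the
  same argument shows that these edges are not both crossed infinitely often.
\<close>

section \<open>Signs, crossing factors and pairs (edge, weight) on the four-cycle\<close>

definition edge_sign :: "nat set \<Rightarrow> real" where
  "edge_sign e = (if e = {0, 1} \<or> e = {2, 3} then 1 else - 1)"

text \<open>The crossing factor is stored through its principal logarithm, which makes sense because
  \<open>1 + \<i> t\<close> is nonzero for real \<open>t\<close>. Products over infinite sets of
  pairs then become unordered sums \<open>infsum\<close>, and moduli become real parts.\<close>

definition log_factor :: "(nat \<Rightarrow> real) \<Rightarrow> real \<Rightarrow> nat set \<times> nat \<Rightarrow> complex" where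
  "log_factor W \<theta> \<kappa> = Ln (1 + \<i> * of_real (edge_sign (fst \<kappa>) * \<theta> / W (snd \<kappa>)))"

text \<open>The weight is read before the crossing is counted, as in the transition probability, so
  this is the pair whose factor step \<open>n\<close> can contribute.\<close>

definition key :: "(nat set \<Rightarrow> nat) \<Rightarrow> (nat \<Rightarrow> nat) \<Rightarrow> nat \<Rightarrow> nat set \<times> nat" where
  "key X0 vs n = ({vs n, vs (Suc n)}, cur_weight X0 vs n {vs n, vs (Suc n)})"

lemma edge_sign_values: "edge_sign e = 1 \<or> edge_sign e = - 1"
  by (simp add: edge_sign_def)

lemma less_4_cases: "v < 4 \<Longrightarrow> v = 0 \<or> v = 1 \<or> v = 2 \<or> v = (3::nat)"
  by linarith

lemma nbr4_less: "nbr4 v w \<Longrightarrow> v < 4" "nbr4 v w \<Longrightarrow> w < 4"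
  by (auto simp: nbr4_def)

text \<open>Signs alternate around the cycle, which is consistent because the length is even. The
  opposite signs at a vertex are what makes the two possible factors average to
  \<open>1\<close>.\<close>

lemma nbr4_cases:
  assumes "v < 4"
  obtains a b where "{w. nbr4 v w} = {a, b}" "a \<noteq> b" "edge_sign {v, b} = - edge_sign {v, a}"
proof (rule that[of "(v + 1) mod 4" "(v + 3) mod 4"])
  have "nbr4 v w \<longleftrightarrow> w = (v + 1) mod 4 \<or> w = (v + 3) mod 4" for w
  proof (cases "w < 4")
    case True
    from less_4_cases[OF assms] less_4_cases[OF True] show ?thesis
      by (elim disjE) (simp_all add: nbr4_def)
  next
    case False
    then have "w \<noteq> u mod 4" for u
      using mod_less_divisor[of 4 u] by linarith
    with False show ?thesis
      by (simp add: nbr4_def)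
  qed
  then show "{w. nbr4 v w} = {(v + 1) mod 4, (v + 3) mod 4}"
    by blast
  show "(v + 1) mod 4 \<noteq> (v + 3) mod 4"
    using less_4_cases[OF assms] by auto
  show "edge_sign {v, (v + 3) mod 4} = - edge_sign {v, (v + 1) mod 4}"
    using less_4_cases[OF assms] by (auto simp: edge_sign_def doubleton_eq_iff)
qed

section \<open>Edge weights along a path\<close>

lemma cur_weight_Suc:
  "cur_weight X0 vs (Suc n) e = cur_weight X0 vs n e + (if {vs n, vs (Suc n)} = e then 1 else 0)"
proof -
  have "{k. k < Suc n \<and> {vs k, vs (Suc k)} = e} =
      {k. k < n \<and> {vs k, vs (Suc k)} = e} \<union> (if {vs n, vs (Suc n)} = e then {n} else {})"
    by (auto simp: less_Suc_eq)
  then show ?thesis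
    by (simp add: cur_weight_def)
qed

lemma cur_weight_mono: "m \<le> n \<Longrightarrow> cur_weight X0 vs m e \<le> cur_weight X0 vs n e"
  by (induction rule: dec_induct) (auto simp: cur_weight_Suc)

lemma cur_weight_cong:
  assumes "\<And>k. k \<le> n \<Longrightarrow> vs k = vs' k"
  shows "cur_weight X0 vs n e = cur_weight X0 vs' n e"
proof -
  have "{k. k < n \<and> {vs k, vs (Suc k)} = e} = {k. k < n \<and> {vs' k, vs' (Suc k)} = e}"
    using assms by (auto simp: Suc_le_eq)
  then show ?thesis
    by (simp add: cur_weight_def)
qed

lemma key_cong:
  assumes "\<And>k. k \<le> Suc n \<Longrightarrow> vs k = vs' k"
  shows "key X0 vs n = key X0 vs' n"
  using assms cur_weight_cong[of n vs vs'] by (simp add: key_def)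

text \<open>Crossing an edge raises its weight at once, so the pair used by a step cannot recur.
  Hence each factor enters the product at most once.\<close>

lemma key_inj:
  assumes "k < n"
  shows "key X0 vs k \<noteq> key X0 vs n"
proof
  assume eq: "key X0 vs k = key X0 vs n"
  have "cur_weight X0 vs (Suc k) {vs k, vs (Suc k)} \<le> cur_weight X0 vs n {vs k, vs (Suc k)}"
    using assms by (intro cur_weight_mono) simp
  then show False
    using eq by (auto simp: key_def cur_weight_Suc)
qed

text \<open>Take the first crossing of \<open>e\<close> at or after time \<open>n\<close>: until
  then the weight of \<open>e\<close> stays constant.\<close>

lemma next_crossing:
  assumes "\<exists>\<^sub>\<infinity>k. {vs k, vs (Suc k)} = e"
  obtains m where "m \<ge> n" "{vs m, vs (Suc m)} = e" "cur_weight X0 vs m e = cur_weight X0 vs n e"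
proof -
  define m where "m = (LEAST m. m \<ge> n \<and> {vs m, vs (Suc m)} = e)"
  have "\<exists>m. m \<ge> n \<and> {vs m, vs (Suc m)} = e"
    using assms unfolding INFM_nat_le by blast
  then have m: "m \<ge> n \<and> {vs m, vs (Suc m)} = e"
    unfolding m_def by (rule LeastI_ex)
  have "j \<le> m \<Longrightarrow> cur_weight X0 vs j e = cur_weight X0 vs n e" if "n \<le> j" for j
    using that
  proof (induction rule: dec_induct)
    case (step j)
    then have "{vs j, vs (Suc j)} \<noteq> e"
      using not_less_Least[of j "\<lambda>m. m \<ge> n \<and> {vs m, vs (Suc m)} = e"] by (auto simp: m_def)
    then show ?case
      using step by (simp add: cur_weight_Suc)
  qed simp
  from this[of m] m show thesis
    by (intro that[of m]) simp_all
qed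

text \<open>Induction on \<open>x\<close>: a crossing raises the weight by exactly one and another
  crossing always follows, so no value is skipped.\<close>

lemma weight_attained:
  assumes "\<exists>\<^sub>\<infinity>k. {vs k, vs (Suc k)} = e" and "cur_weight X0 vs N e \<le> x"
  shows "\<exists>n\<ge>N. key X0 vs n = (e, x)"
  using assms(2)
proof (induction rule: dec_induct)
  case base
  obtain m where "m \<ge> N" "{vs m, vs (Suc m)} = e" "cur_weight X0 vs m e = cur_weight X0 vs N e"
    using next_crossing[OF assms(1)] .
  then show ?case
    by (auto simp: key_def)
next
  case (step x)
  then obtain n where n: "n \<ge> N" "key X0 vs n = (e, x)"
    by auto
  obtain m where "m \<ge> Suc n" "{vs m, vs (Suc m)} = e"
      "cur_weight X0 vs m e = cur_weight X0 vs (Suc n) e"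
    using next_crossing[OF assms(1)] .
  moreover have "{vs n, vs (Suc n)} = e" "cur_weight X0 vs n e = x"
    using n by (auto simp: key_def)
  ultimately have "m \<ge> N" "key X0 vs m = (e, Suc x)"
    using n(1) by (simp_all add: key_def cur_weight_Suc)
  then show ?case
    by blast
qed

section \<open>Crossing factors and their infinite products\<close>

lemma norm_one_plus_imaginary: "norm (1 + \<i> * of_real t) = sqrt (1 + t\<^sup>2)"
  by (simp add: cmod_def)

lemma one_plus_imaginary_nonzero: "1 + \<i> * of_real t \<noteq> 0"
  by (simp add: complex_eq_iff)

lemma exp_log_factor:
  "exp (log_factor W \<theta> (e, x)) = 1 + \<i> * of_real (edge_sign e * \<theta> / W x)"
  unfolding log_factor_def fst_conv snd_conv by (rule exp_Ln[OF one_plus_imaginary_nonzero])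

lemma Re_log_factor: "Re (log_factor W \<theta> \<kappa>) = ln (sqrt (1 + (\<theta> / W (snd \<kappa>))\<^sup>2))"
proof -
  have "(edge_sign (fst \<kappa>) * \<theta> / W (snd \<kappa>))\<^sup>2 = (\<theta> / W (snd \<kappa>))\<^sup>2"
    using edge_sign_values[of "fst \<kappa>"] by (auto simp: power2_eq_square)
  then show ?thesis
    unfolding log_factor_def
    by (simp only: Re_Ln[OF one_plus_imaginary_nonzero] norm_one_plus_imaginary)
qed

lemma Re_log_factor_nonneg: "Re (log_factor W \<theta> \<kappa>) \<ge> 0"
  by (simp add: Re_log_factor)

text \<open>As \<open>E\<close> is finite, it suffices to sum over the weights of one edge, where
  the logarithm is eventually dominated by a multiple of \<open>1 / W k\<close>.\<close>

lemma log_factor_summable_on: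
  assumes "summable (\<lambda>k. 1 / W k)" and pos: "\<And>k. W k > 0"
    and "finite E" and "K \<subseteq> E \<times> UNIV"
  shows "log_factor W \<theta> summable_on K"
proof -
  have row: "(\<lambda>x. norm (log_factor W \<theta> (e, x))) summable_on UNIV" for e
  proof -
    have s: "summable (\<lambda>k. 2 * \<bar>\<theta>\<bar> * (1 / W k))"
      using assms(1) by (rule summable_mult)
    have "(\<lambda>k. 2 * \<bar>\<theta>\<bar> * (1 / W k)) \<longlonglongrightarrow> 0"
      using s by (rule summable_LIMSEQ_zero)
    \<comment> \<open>The estimate \<open>|Ln (1 + z)| <= 2 |z|\<close> requires
      \<open>|z| < 1/2\<close>, and here \<open>|z| = |\<theta>| / W k\<close>.\<close>
    then have "eventually (\<lambda>k. 2 * \<bar>\<theta>\<bar> * (1 / W k) < 1) sequentially"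
      by (rule order_tendstoD) simp
    then have "eventually (\<lambda>k. norm (norm (log_factor W \<theta> (e, k))) \<le> 2 * \<bar>\<theta>\<bar> * (1 / W k)) sequentially"
    proof eventually_elim
      case (elim k)
      let ?z = "\<i> * of_real (edge_sign e * \<theta> / W k) :: complex"
      have n: "norm ?z = \<bar>\<theta>\<bar> * (1 / W k)"
        using edge_sign_values[of e] pos[of k]
        by (auto simp: norm_mult norm_divide simp flip: of_real_divide of_real_mult)
      then have "norm (Ln (1 + ?z)) \<le> 2 * norm ?z"
        using elim by (intro norm_Ln_le) (simp only: n)
      then show ?case
        using n by (simp add: log_factor_def)
    qed
    then have "summable (\<lambda>k. norm (log_factor W \<theta> (e, k)))"
      using s by (rule summable_comparison_test_ev)
    then show ?thesis
      by (simp add: summable_on_UNIV_nonneg_real_iff)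
  qed
  have "(\<lambda>\<kappa>. norm (log_factor W \<theta> \<kappa>)) summable_on E \<times> UNIV"
    using row \<open>finite E\<close>
    by (intro summable_on_SigmaI[where g = "\<lambda>e. \<Sum>\<^sub>\<infinity>x. norm (log_factor W \<theta> (e, x))"]) auto
  then have "log_factor W \<theta> summable_on E \<times> UNIV"
    by (rule abs_summable_summable)
  then show ?thesis
    using \<open>K \<subseteq> E \<times> UNIV\<close> by (rule summable_on_subset_banach)
qed

text \<open>The exponent is minus the sum of \<open>g\<close> over \<open>K - A\<close>, whose terms
  have nonnegative real parts. Dropping all of them gives the first bound; keeping only the term at
  \<open>\<kappa>\<close> gives the second.\<close>

lemma norm_exp_infsum_diff:
  fixes g :: "'b \<Rightarrow> complex"
  assumes "g summable_on K" and "\<And>\<kappa>. \<kappa> \<in> K \<Longrightarrow> Re (g \<kappa>) \<ge> 0" and "A \<subseteq> K"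
  shows "norm (exp (infsum g A - infsum g K)) \<le> 1"
    and "\<kappa> \<in> K - A \<Longrightarrow> norm (exp (infsum g A - infsum g K)) \<le> norm (exp (- g \<kappa>))"
proof -
  have sA: "g summable_on A" and sD: "g summable_on (K - A)"
    using assms(1,3) by (auto intro: summable_on_subset_banach)
  have "infsum g (K - A) = infsum g K - infsum g A"
    using assms(1,3) sA by (intro infsum_Diff)
  then have eq: "Re (infsum g A - infsum g K) = - infsum (\<lambda>\<kappa>. Re (g \<kappa>)) (K - A)"
    using infsum_Re[OF sD] by simp
  have "infsum (\<lambda>\<kappa>. Re (g \<kappa>)) (K - A) \<ge> 0"
    using assms(2) by (intro infsum_nonneg) auto
  then show "norm (exp (infsum g A - infsum g K)) \<le> 1"
    using eq by simp
  assume "\<kappa> \<in> K - A"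
  then have "infsum (\<lambda>\<kappa>. Re (g \<kappa>)) {\<kappa>} \<le> infsum (\<lambda>\<kappa>. Re (g \<kappa>)) (K - A)"
    using assms(2) by (intro infsum_mono_neutral summable_on_Re sD) auto
  then show "norm (exp (infsum g A - infsum g K)) \<le> norm (exp (- g \<kappa>))"
    using eq by simp
qed

lemma exp_log_factor_vanishes:
  assumes "W (snd \<kappa>) > 0"
  shows "(\<lambda>n. norm (exp (- log_factor W (real n) \<kappa>))) \<longlonglongrightarrow> 0"
proof -
  have "(\<lambda>n. 1 / sqrt (1 + (real n / W (snd \<kappa>))\<^sup>2)) \<longlonglongrightarrow> 0"
    using assms by real_asymp
  moreover have "norm (exp (- log_factor W \<theta> \<kappa>)) = 1 / sqrt (1 + (\<theta> / W (snd \<kappa>))\<^sup>2)" for \<theta>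
  proof -
    have "sqrt (1 + (\<theta> / W (snd \<kappa>))\<^sup>2) > 0"
      by (simp add: add_pos_nonneg)
    then have "exp (Re (log_factor W \<theta> \<kappa>)) = sqrt (1 + (\<theta> / W (snd \<kappa>))\<^sup>2)"
      unfolding Re_log_factor by (rule exp_ln)
    then show ?thesis
      unfolding norm_exp_eq_Re uminus_complex.sel by (simp add: exp_minus inverse_eq_divide del: ln_sqrt)
  qed
  ultimately show ?thesis
    by simp
qed

section \<open>Cylinder events and measurability\<close>

locale errw4 = prob_space M for M :: "'a measure" +
  fixes I :: "nat \<Rightarrow> 'a \<Rightarrow> nat" and W :: "nat \<Rightarrow> real" and X0 :: "nat set \<Rightarrow> nat" and v0 :: nat
  assumes W_pos: "\<And>k. W k > 0"
    and I_measurable: "\<And>n. I n \<in> measurable M (count_space UNIV)"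
    and law: "\<And>n vs. prob {\<omega> \<in> space M. \<forall>k\<le>n. I k \<omega> = vs k} =
        (if vs 0 = v0 then 1 else 0) * (\<Prod>k<n. errw_step W X0 vs k)"
begin

definition cyl :: "(nat \<Rightarrow> nat) \<Rightarrow> nat \<Rightarrow> 'a set" where
  "cyl vs n = {\<omega> \<in> space M. \<forall>k\<le>n. I k \<omega> = vs k}"

definition path :: "'a \<Rightarrow> nat \<Rightarrow> nat" where
  "path \<omega> = (\<lambda>k. I k \<omega>)"

text \<open>The function factors through the list of the first \<open>n + 1\<close> positions. Lists
  of naturals form a countable discrete space, on which every function is measurable.\<close>

lemma finite_dependence_measurable:
  assumes "\<And>vs vs'. (\<And>k. k \<le> n \<Longrightarrow> vs k = vs' k) \<Longrightarrow> Z vs = Z vs'" and "\<And>x. Z x \<in> space N"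
  shows "(\<lambda>\<omega>. Z (path \<omega>)) \<in> measurable M N"
proof -
  let ?L = "\<lambda>\<omega>. map (\<lambda>k. I k \<omega>) [0..<Suc n]"
  have "?L \<in> measurable M (count_space UNIV)"
  proof (subst measurable_count_space_eq_countable; (intro conjI ballI)?)
    fix xs :: "nat list"
    have "?L -` {xs} \<inter> space M =
        {\<omega> \<in> space M. length xs = Suc n \<and> (\<forall>k\<in>{..n}. I k \<omega> = xs ! k)}"
      by (auto simp: list_eq_iff_nth_eq less_Suc_eq_le nth_append simp del: upt_Suc)
    also have "\<dots> \<in> sets M"
      using I_measurable by measurable
    finally show "?L -` {xs} \<inter> space M \<in> sets M" .
  qed auto
  then have "(\<lambda>\<omega>. Z (\<lambda>k. ?L \<omega> ! k)) \<in> measurable M N"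
    by (rule measurable_compose) (use assms(2) in simp)
  also have "(\<lambda>\<omega>. Z (\<lambda>k. ?L \<omega> ! k)) = (\<lambda>\<omega>. Z (path \<omega>))"
    by (intro ext assms(1)) (simp add: path_def less_Suc_eq_le nth_append del: upt_Suc)
  finally show ?thesis .
qed

lemma cyl_sets [measurable]: "cyl vs n \<in> sets M"
  unfolding cyl_def using I_measurable by measurable

text \<open>The earlier factors of the product law do not see the vertex at time
  \<open>Suc n\<close>, so extending a cylinder only appends one factor.\<close>

lemma prob_cyl_Suc:
  "prob (cyl (vs(Suc n := w)) (Suc n)) = errw_step W X0 (vs(Suc n := w)) n * prob (cyl vs n)"
proof -
  have "errw_step W X0 (vs(Suc n := w)) k = errw_step W X0 vs k" if "k < n" for k
  proof -
    have "cur_weight X0 (vs(Suc n := w)) k = cur_weight X0 vs k"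
      using that by (intro ext cur_weight_cong) simp
    then show ?thesis
      using that by (simp add: errw_step_def)
  qed
  then have "(\<Prod>k<n. errw_step W X0 (vs(Suc n := w)) k) = (\<Prod>k<n. errw_step W X0 vs k)"
    by (intro prod.cong) simp_all
  then show ?thesis
    unfolding cyl_def law prod.lessThan_Suc by simp
qed

lemma errw_step_upd:
  "errw_step W X0 (vs(Suc n := w)) n =
     (if nbr4 (vs n) w
      then W (cur_weight X0 vs n {vs n, w}) / (\<Sum>u | nbr4 (vs n) u. W (cur_weight X0 vs n {vs n, u}))
      else 0)"
proof -
  have "cur_weight X0 (vs(Suc n := w)) n = cur_weight X0 vs n"
    by (intro ext cur_weight_cong) simp
  then show ?thesis
    by (simp add: errw_step_def)
qed

lemma ex_cylinder: "\<omega> \<in> space M \<Longrightarrow> \<exists>xs. \<omega> \<in> cyl (\<lambda>k. xs ! k) n"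
  by (rule exI[of _ "map (\<lambda>k. I k \<omega>) [0..<Suc n]"]) (auto simp: cyl_def less_Suc_eq_le nth_append simp del: upt_Suc)

text \<open>Only the first \<open>n + 1\<close> positions matter, so the cylinders can be indexed by
  finite lists. These are countably many, hence the exceptional null sets can be united.\<close>

lemma AE_cylinderwise:
  assumes "\<And>vs. AE \<omega> in M. \<omega> \<in> cyl vs n \<longrightarrow> P \<omega>"
  shows "AE \<omega> in M. P \<omega>"
proof -
  have "AE \<omega> in M. \<forall>xs :: nat list. \<omega> \<in> cyl (\<lambda>k. xs ! k) n \<longrightarrow> P \<omega>"
    using assms by (subst AE_all_countable) auto
  then show ?thesis
    using AE_space by eventually_elim (use ex_cylinder in blast)
qed

section \<open>One-step decomposition and the martingale identity\<close>

lemma AE_nbr4: "AE \<omega> in M. \<forall>n. nbr4 (I n \<omega>) (I (Suc n) \<omega>)"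
proof (subst AE_all_countable, intro allI)
  fix n
  show "AE \<omega> in M. nbr4 (I n \<omega>) (I (Suc n) \<omega>)"
  proof (rule AE_cylinderwise[of "Suc n"])
    fix vs
    show "AE \<omega> in M. \<omega> \<in> cyl vs (Suc n) \<longrightarrow> nbr4 (I n \<omega>) (I (Suc n) \<omega>)"
    proof (cases "nbr4 (vs n) (vs (Suc n))")
      case False
      then have "prob (cyl vs (Suc n)) = 0"
        by (simp add: cyl_def law errw_step_def)
      then have "AE \<omega> in M. \<omega> \<notin> cyl vs (Suc n)"
        by (simp add: prob_eq_0)
      then show ?thesis
        by eventually_elim simp
    qed (auto simp: cyl_def)
  qed
qed

text \<open>Since steps almost surely go to neighbours, a cylinder is, up to a null set, the
  disjoint union of its extensions by a neighbour of its last vertex.\<close>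

lemma integral_cyl_split:
  fixes f :: "'a \<Rightarrow> complex"
  assumes [measurable]: "integrable M f"
  shows "(\<integral>\<omega>. indicator (cyl vs n) \<omega> *\<^sub>R f \<omega> \<partial>M) =
    (\<Sum>w | nbr4 (vs n) w. \<integral>\<omega>. indicator (cyl (vs(Suc n := w)) (Suc n)) \<omega> *\<^sub>R f \<omega> \<partial>M)"
proof -
  have fin: "finite {w. nbr4 (vs n) w}"
    by (rule finite_subset[of _ "{..<4}"]) (auto simp: nbr4_def)
  have int: "integrable M (\<lambda>\<omega>. indicator (cyl vs m) \<omega> *\<^sub>R f \<omega>)" for vs m
    using assms by (intro integrable_mult_indicator) auto
  have "(\<integral>\<omega>. indicator (cyl vs n) \<omega> *\<^sub>R f \<omega> \<partial>M) =
    (\<integral>\<omega>. (\<Sum>w | nbr4 (vs n) w. indicator (cyl (vs(Suc n := w)) (Suc n)) \<omega> *\<^sub>R f \<omega>) \<partial>M)"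
  proof (rule integral_cong_AE)
    show "AE \<omega> in M. indicator (cyl vs n) \<omega> *\<^sub>R f \<omega> =
      (\<Sum>w | nbr4 (vs n) w. indicator (cyl (vs(Suc n := w)) (Suc n)) \<omega> *\<^sub>R f \<omega>)"
      using AE_nbr4 AE_space
    proof eventually_elim
      case (elim \<omega>)
      have *: "indicator (cyl (vs(Suc n := w)) (Suc n)) \<omega> =
          (if w = I (Suc n) \<omega> then indicator (cyl vs n) \<omega> else 0 :: real)" for w
        by (auto simp: cyl_def indicator_def le_Suc_eq)
      show ?case
      proof (cases "\<omega> \<in> cyl vs n")
        case True
        then have "nbr4 (vs n) (I (Suc n) \<omega>)"
          using elim(1) by (auto simp: cyl_def) (metis order_refl)
        then show ?thesis
          using fin unfolding * by (simp add: if_distrib[of "\<lambda>c. c *\<^sub>R _"] sum.delta' cong: if_cong)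
      next
        case False
        then show ?thesis
          unfolding * by (simp add: sum.neutral)
      qed
    qed
  qed (use int in \<open>auto intro!: borel_measurable_sum\<close>)
  also have "\<dots> = (\<Sum>w | nbr4 (vs n) w. \<integral>\<omega>. indicator (cyl (vs(Suc n := w)) (Suc n)) \<omega> *\<^sub>R f \<omega> \<partial>M)"
    by (rule Bochner_Integration.integral_sum) (rule int)
  finally show ?thesis .
qed

lemma prob_cyl_pos_imp_nbr4:
  assumes "prob (cyl vs n) \<noteq> 0"
  shows "\<forall>k<n. nbr4 (vs k) (vs (Suc k))" and "vs n < 4"
proof -
  have prod: "(\<Prod>k<n. errw_step W X0 vs k) \<noteq> 0"
    using assms unfolding cyl_def law by (metis mult_zero_right)
  show "\<forall>k<n. nbr4 (vs k) (vs (Suc k))"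
  proof (intro allI impI)
    fix k assume "k < n"
    with prod have "errw_step W X0 vs k \<noteq> 0"
      by simp
    then show "nbr4 (vs k) (vs (Suc k))"
      by (rule contrapos_np) (simp add: errw_step_def)
  qed
  \<comment> \<open>The law of the cylinder has no factor for a step out of \<open>vs n\<close>. The
    bound follows instead because the walk almost surely moves on to a neighbour, and a vertex
    outside the cycle has none.\<close>
  show "vs n < 4"
  proof (rule ccontr)
    assume "\<not> vs n < 4"
    then have no: "\<not> nbr4 (vs n) w" for w
      using nbr4_less(1) by blast
    have "\<omega> \<notin> cyl vs n" if "\<forall>m. nbr4 (I m \<omega>) (I (Suc m) \<omega>)" for \<omega>
    proof
      assume "\<omega> \<in> cyl vs n"
      then have "I n \<omega> = vs n"
        by (simp add: cyl_def)
      with that no show False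
        by metis
    qed
    with AE_nbr4 have "AE \<omega> in M. \<omega> \<notin> cyl vs n"
      by (rule eventually_mono)
    then have "prob (cyl vs n) = 0"
      by (simp add: prob_eq_0)
    with assms show False by simp
  qed
qed

text \<open>This is the martingale property in integrated form, given the history \<open>vs0\<close>
  up to time \<open>N\<close>. It avoids conditional expectations by integrating out the last step
  repeatedly, from time \<open>n\<close> back to \<open>N\<close>.\<close>

lemma integral_harmonic:
  fixes Z :: "nat \<Rightarrow> (nat \<Rightarrow> nat) \<Rightarrow> complex"
  assumes dep: "\<And>n vs vs'. (\<And>k. k \<le> n \<Longrightarrow> vs k = vs' k) \<Longrightarrow> Z n vs = Z n vs'"
    and bound: "\<And>n vs. norm (Z n vs) \<le> 1"
    and harmonic: "\<And>n vs. N \<le> n \<Longrightarrow> (\<And>k. k \<le> N \<Longrightarrow> vs k = vs0 k) \<Longrightarrow>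
        (\<And>k. k < n \<Longrightarrow> nbr4 (vs k) (vs (Suc k))) \<Longrightarrow> vs n < 4 \<Longrightarrow>
        (\<Sum>w | nbr4 (vs n) w. of_real (errw_step W X0 (vs(Suc n := w)) n) * Z (Suc n) (vs(Suc n := w))) = Z n vs"
    and "N \<le> n"
  shows "(\<integral>\<omega>. indicator (cyl vs0 N) \<omega> *\<^sub>R Z n (path \<omega>) \<partial>M) = Z N vs0 * of_real (prob (cyl vs0 N))"
proof -
  have int: "integrable M (\<lambda>\<omega>. Z n (path \<omega>))"
    by (rule integrable_const_bound[of _ 1]) (use bound in \<open>auto intro!: finite_dependence_measurable dep\<close>)
  \<comment> \<open>The downward induction on \<open>m\<close> needs the claim for all extensions
    \<open>vs\<close> of the history \<open>vs0\<close>.\<close>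
  have "(\<And>k. k \<le> N \<Longrightarrow> vs k = vs0 k) \<Longrightarrow>
      (\<integral>\<omega>. indicator (cyl vs m) \<omega> *\<^sub>R Z n (path \<omega>) \<partial>M) = Z m vs * of_real (prob (cyl vs m))"
    if "m \<le> n" "N \<le> m" for m vs
    using that
  proof (induction arbitrary: vs rule: inc_induct)
    case base
    have "(\<integral>\<omega>. indicator (cyl vs n) \<omega> *\<^sub>R Z n (path \<omega>) \<partial>M) = (\<integral>\<omega>. indicator (cyl vs n) \<omega> *\<^sub>R Z n vs \<partial>M)"
    proof (rule Bochner_Integration.integral_cong)
      fix \<omega>
      have "\<omega> \<in> cyl vs n \<Longrightarrow> Z n (path \<omega>) = Z n vs"
        by (rule dep) (auto simp: cyl_def path_def)
      then show "indicator (cyl vs n) \<omega> *\<^sub>R Z n (path \<omega>) = indicator (cyl vs n) \<omega> *\<^sub>R Z n vs"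
        by (cases "\<omega> \<in> cyl vs n") simp_all
    qed simp
    then show ?case
      by (simp add: scaleR_conv_of_real mult.commute)
  next
    case (step m)
    have "(\<integral>\<omega>. indicator (cyl vs m) \<omega> *\<^sub>R Z n (path \<omega>) \<partial>M) =
      (\<Sum>w | nbr4 (vs m) w. \<integral>\<omega>. indicator (cyl (vs(Suc m := w)) (Suc m)) \<omega> *\<^sub>R Z n (path \<omega>) \<partial>M)"
      by (rule integral_cyl_split[OF int])
    also have "\<dots> = (\<Sum>w | nbr4 (vs m) w. Z (Suc m) (vs(Suc m := w)) * of_real (prob (cyl (vs(Suc m := w)) (Suc m))))"
      using step by (intro sum.cong refl step.IH) auto
    also have "\<dots> = (\<Sum>w | nbr4 (vs m) w. of_real (errw_step W X0 (vs(Suc m := w)) m) * Z (Suc m) (vs(Suc m := w)))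
        * of_real (prob (cyl vs m))"
      unfolding prob_cyl_Suc sum_distrib_right by (intro sum.cong refl) simp
    also have "\<dots> = Z m vs * of_real (prob (cyl vs m))"
    \<comment> \<open>On a null history both sides vanish; any other history is a path in the cycle,
      as \<open>harmonic\<close> demands.\<close>
    proof (cases "prob (cyl vs m) = 0")
      case False
      then show ?thesis
        using prob_cyl_pos_imp_nbr4[OF False] step by (subst harmonic) auto
    qed simp
    finally show ?case .
  qed
  from this[of N vs0] \<open>N \<le> n\<close> show ?thesis by simp
qed

text \<open>The selection rule \<open>act\<close> is predictable: at time \<open>n\<close> it sees
  only the positions up to \<open>n\<close>, so it does not favour either of the two next steps.
  Fixing the history \<open>vs0\<close> up to \<open>N\<close> allows \<open>K\<close> to depend on
  that history.\<close>

lemma exhausted_AE: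
  fixes K :: "(nat set \<times> nat) set" and act :: "nat \<Rightarrow> (nat \<Rightarrow> nat) \<Rightarrow> bool"
  assumes summ: "summable (\<lambda>k. 1 / W k)"
    and K: "finite E" "K \<subseteq> E \<times> UNIV" "K \<noteq> {}"
    and act_cong: "\<And>n vs vs'. (\<And>k. k \<le> n \<Longrightarrow> vs k = vs' k) \<Longrightarrow> act n vs = act n vs'"
    and key_in: "\<And>n vs. N \<le> n \<Longrightarrow> (\<And>k. k \<le> N \<Longrightarrow> vs k = vs0 k) \<Longrightarrow>
        (\<And>k. k \<le> n \<Longrightarrow> nbr4 (vs k) (vs (Suc k))) \<Longrightarrow> act n vs \<Longrightarrow> key X0 vs n \<in> K"
  shows "AE \<omega> in M. \<omega> \<in> cyl vs0 N \<longrightarrow>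
    \<not> (\<forall>\<kappa>\<in>K. \<exists>n\<ge>N. act n (path \<omega>) \<and> key X0 (path \<omega>) n = \<kappa>)"
proof -
  \<comment> \<open>Intersecting with \<open>K\<close> makes the bounds on \<open>Z\<close> hold for
    every sequence, including those to which \<open>key_in\<close> does not apply.\<close>
  define used where "used n vs = key X0 vs ` {k. N \<le> k \<and> k < n \<and> act k vs} \<inter> K" for n vs
  define g where "g = log_factor W"
  \<comment> \<open>The product of the factors used so far divided by the product over
    \<open>K\<close>, in logarithmic form.\<close>
  define Z where "Z \<theta> n vs = exp (infsum (g \<theta>) (used n vs) - infsum (g \<theta>) K)" for \<theta> n vs
  define U where "U vs = (\<Union>n. used n vs)" for vs
  define Zlim where "Zlim \<theta> vs = exp (infsum (g \<theta>) (U vs) - infsum (g \<theta>) K)" for \<theta> vs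
  have g_summable: "g \<theta> summable_on K" for \<theta>
    unfolding g_def using summ W_pos K(1,2) by (rule log_factor_summable_on)
  have g_Re: "Re (g \<theta> \<kappa>) \<ge> 0" for \<theta> \<kappa>
    unfolding g_def by (rule Re_log_factor_nonneg)
  have used_K: "used n vs \<subseteq> K" and U_K: "U vs \<subseteq> K" and used_fin: "finite (used n vs)" for n vs
    by (auto simp: used_def U_def)
  have used_mono: "used m vs \<subseteq> used n vs" if "m \<le> n" for m n vs
    using that unfolding used_def by fastforce
  have Z_bound: "norm (Z \<theta> n vs) \<le> 1" for \<theta> n vs
    unfolding Z_def using g_summable g_Re used_K by (intro norm_exp_infsum_diff)
  have Zlim_bound: "norm (Zlim \<theta> vs) \<le> 1" for \<theta> vs
    unfolding Zlim_def using g_summable g_Re U_K by (intro norm_exp_infsum_diff)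
  have used_cong: "used n vs = used n vs'" if "\<And>k. k \<le> n \<Longrightarrow> vs k = vs' k" for n vs vs'
  proof -
    have "act k vs = act k vs'" "key X0 vs k = key X0 vs' k" if "k < n" for k
      using that \<open>\<And>k. k \<le> n \<Longrightarrow> vs k = vs' k\<close> by (auto intro!: act_cong key_cong)
    then have "key X0 vs ` {k. N \<le> k \<and> k < n \<and> act k vs} = key X0 vs' ` {k. N \<le> k \<and> k < n \<and> act k vs'}"
      by (intro image_cong) auto
    then show ?thesis
      by (simp add: used_def)
  qed
  have Z_cong: "Z \<theta> n vs = Z \<theta> n vs'" if "\<And>k. k \<le> n \<Longrightarrow> vs k = vs' k" for \<theta> n vs vs'
    using used_cong[of n vs vs'] that by (simp add: Z_def)
  have Z_meas [measurable]: "(\<lambda>\<omega>. Z \<theta> n (path \<omega>)) \<in> borel_measurable M" for \<theta> n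
    by (rule finite_dependence_measurable[of n]) (auto intro: Z_cong)

  have Z_step: "Z \<theta> (Suc n) vs = (if act n vs then exp (g \<theta> (key X0 vs n)) else 1) * Z \<theta> n vs"
    if "N \<le> n" "\<And>k. k \<le> N \<Longrightarrow> vs k = vs0 k" "\<And>k. k \<le> n \<Longrightarrow> nbr4 (vs k) (vs (Suc k))" for \<theta> n vs
  proof (cases "act n vs")
    case True
    have "key X0 vs n \<in> K"
      using that True by (intro key_in)
    then have "used (Suc n) vs = insert (key X0 vs n) (used n vs)"
      using True \<open>N \<le> n\<close> by (auto simp: used_def less_Suc_eq)
    \<comment> \<open>The pair is fresh, so the sum in the exponent gains exactly one term.\<close>
    moreover have "key X0 vs n \<notin> used n vs"
      using key_inj by (auto simp: used_def) metis
    ultimately show ?thesis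
      using True used_fin[of n vs] by (simp add: Z_def exp_add[symmetric] algebra_simps)
  next
    case False
    then have "used (Suc n) vs = used n vs"
      by (auto simp: used_def less_Suc_eq)
    with False show ?thesis
      by (simp add: Z_def)
  qed
  have harmonic: "(\<Sum>w | nbr4 (vs n) w. of_real (errw_step W X0 (vs(Suc n := w)) n) * Z \<theta> (Suc n) (vs(Suc n := w))) = Z \<theta> n vs"
    if "N \<le> n" "\<And>k. k \<le> N \<Longrightarrow> vs k = vs0 k" "\<And>k. k < n \<Longrightarrow> nbr4 (vs k) (vs (Suc k))" "vs n < 4" for \<theta> n vs
  proof -
    obtain a b where ab: "{w. nbr4 (vs n) w} = {a, b}" "a \<noteq> b" "edge_sign {vs n, b} = - edge_sign {vs n, a}"
      using nbr4_cases[OF \<open>vs n < 4\<close>] .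
    define x where "x w = cur_weight X0 vs n {vs n, w}" for w
    have up: "Z \<theta> (Suc n) (vs(Suc n := w)) =
        (if act n vs then 1 + \<i> * of_real (edge_sign {vs n, w} * \<theta> / W (x w)) else 1) * Z \<theta> n vs"
      if "nbr4 (vs n) w" for w
    proof -
      have "key X0 (vs(Suc n := w)) n = ({vs n, w}, x w)"
        using cur_weight_cong[of n "vs(Suc n := w)" vs] by (simp add: key_def x_def)
      moreover have "act n (vs(Suc n := w)) = act n vs"
        by (rule act_cong) simp
      moreover have "Z \<theta> n (vs(Suc n := w)) = Z \<theta> n vs"
        by (rule Z_cong) simp
      moreover have "nbr4 ((vs(Suc n := w)) k) ((vs(Suc n := w)) (Suc k))" if "k \<le> n" for k
        using \<open>nbr4 (vs n) w\<close> \<open>\<And>k. k < n \<Longrightarrow> nbr4 (vs k) (vs (Suc k))\<close> that by (cases "k = n") auto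
      ultimately show ?thesis
        using Z_step[of n "vs(Suc n := w)" \<theta>] \<open>N \<le> n\<close> \<open>\<And>k. k \<le> N \<Longrightarrow> vs k = vs0 k\<close>
        by (simp only: g_def exp_log_factor) auto
    qed
    define A where "A = W (x a)"
    define B where "B = W (x b)"
    have pos: "A > 0" "B > 0"
      by (simp_all add: A_def B_def W_pos)
    have nb: "nbr4 (vs n) a" "nbr4 (vs n) b"
      using ab(1) by auto
    have stp: "errw_step W X0 (vs(Suc n := a)) n = A / (A + B)" "errw_step W X0 (vs(Suc n := b)) n = B / (A + B)"
      unfolding errw_step_upd ab(1) using nb \<open>a \<noteq> b\<close> by (simp_all add: A_def B_def x_def)
    define s where "s = edge_sign {vs n, a} * \<theta>"
    \<comment> \<open>The jump probabilities are proportional to \<open>A\<close> and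
      \<open>B\<close>, which cancel the denominators; the imaginary parts are then opposite because
      the signs are.\<close>
    have "of_real (A / (A + B)) * (1 + \<i> * of_real (s / A)) + of_real (B / (A + B)) * (1 + \<i> * of_real (- s / B)) = (1 :: complex)"
      using pos by (simp add: complex_eq_iff add_divide_distrib[symmetric])
    moreover have "of_real (A / (A + B)) + of_real (B / (A + B)) = (1 :: complex)"
      using pos by (simp add: complex_eq_iff add_divide_distrib[symmetric])
    ultimately show ?thesis
      unfolding ab(1) using \<open>a \<noteq> b\<close>
      by (simp add: up[OF nb(1)] up[OF nb(2)] stp ab(3) s_def[symmetric] A_def[symmetric] B_def[symmetric]
          mult.assoc[symmetric] distrib_right[symmetric] del: of_real_divide of_real_mult of_real_add)
  qed

  have Z_lim: "(\<lambda>n. Z \<theta> n vs) \<longlonglongrightarrow> Zlim \<theta> vs" for \<theta> vs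
  proof -
    \<comment> \<open>The finite sets \<open>used n vs\<close> increase to \<open>U vs\<close>, so
      they run through the net that defines the unordered sum.\<close>
    have "filterlim (\<lambda>n. used n vs) (finite_subsets_at_top (U vs)) sequentially"
      unfolding filterlim_finite_subsets_at_top
    proof safe
      fix Y assume "finite Y" "Y \<subseteq> U vs"
      then have "eventually (\<lambda>n. Y \<subseteq> used n vs) sequentially"
      proof (induction Y)
        case (insert y Y)
        then obtain n where "y \<in> used n vs"
          by (auto simp: U_def)
        then have "eventually (\<lambda>n. y \<in> used n vs) sequentially"
          using used_mono by (intro eventually_sequentiallyI[of n]) blast
        moreover have "eventually (\<lambda>n. Y \<subseteq> used n vs) sequentially"
          using insert by auto
        ultimately show ?case
          by eventually_elim auto
      qed simp
      then show "eventually (\<lambda>n. finite (used n vs) \<and> Y \<subseteq> used n vs \<and> used n vs \<subseteq> U vs) sequentially"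
        by eventually_elim (use used_fin in \<open>auto simp: U_def\<close>)
    qed
    moreover have "(sum (g \<theta>) \<longlongrightarrow> infsum (g \<theta>) (U vs)) (finite_subsets_at_top (U vs))"
      using summable_on_subset_banach[OF g_summable U_K] by (rule infsum_tendsto)
    ultimately have "(\<lambda>n. sum (g \<theta>) (used n vs)) \<longlonglongrightarrow> infsum (g \<theta>) (U vs)"
      by (rule filterlim_compose[rotated])
    then show ?thesis
      unfolding Z_def Zlim_def using used_fin by (auto intro!: tendsto_intros)
  qed
  have Zlim_meas [measurable]: "(\<lambda>\<omega>. Zlim \<theta> (path \<omega>)) \<in> borel_measurable M" for \<theta>
    by (rule borel_measurable_LIMSEQ_metric[OF Z_meas Z_lim])
  have integral_Zlim: "(\<integral>\<omega>. indicator (cyl vs0 N) \<omega> *\<^sub>R Zlim \<theta> (path \<omega>) \<partial>M) = Z \<theta> N vs0 * of_real (prob (cyl vs0 N))" for \<theta>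
  proof (rule LIMSEQ_unique)
    show "(\<lambda>n. \<integral>\<omega>. indicator (cyl vs0 N) \<omega> *\<^sub>R Z \<theta> n (path \<omega>) \<partial>M) \<longlonglongrightarrow> (\<integral>\<omega>. indicator (cyl vs0 N) \<omega> *\<^sub>R Zlim \<theta> (path \<omega>) \<partial>M)"
      by (rule integral_dominated_convergence[where w = "\<lambda>_. 1"])
        (use Z_bound in \<open>auto intro!: tendsto_intros Z_lim simp: indicator_def\<close>)
    have "(\<integral>\<omega>. indicator (cyl vs0 N) \<omega> *\<^sub>R Z \<theta> n (path \<omega>) \<partial>M) = Z \<theta> N vs0 * of_real (prob (cyl vs0 N))" if "N \<le> n" for n
      by (rule integral_harmonic[OF Z_cong Z_bound harmonic that])
    then show "(\<lambda>n. \<integral>\<omega>. indicator (cyl vs0 N) \<omega> *\<^sub>R Z \<theta> n (path \<omega>) \<partial>M) \<longlonglongrightarrow> Z \<theta> N vs0 * of_real (prob (cyl vs0 N))"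
      by (intro tendsto_eventually eventually_sequentiallyI[of N])
  qed
  have vanish: "(\<lambda>j. exp (infsum (g (real j)) A - infsum (g (real j)) K)) \<longlonglongrightarrow> 0" if "A \<subset> K" for A
  proof -
    obtain \<kappa> where \<kappa>: "\<kappa> \<in> K - A"
      using \<open>A \<subset> K\<close> by blast
    have "norm (exp (infsum (g (real j)) A - infsum (g (real j)) K)) \<le> norm (exp (- g (real j) \<kappa>))" for j
      using g_summable g_Re \<open>A \<subset> K\<close> \<kappa> by (intro norm_exp_infsum_diff) auto
    moreover have "(\<lambda>j. norm (exp (- g (real j) \<kappa>))) \<longlonglongrightarrow> 0"
      unfolding g_def using W_pos by (rule exp_log_factor_vanishes)
    ultimately show ?thesis
      by (rule Lim_null_comparison[OF always_eventually[OF allI]])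
  qed
  \<comment> \<open>The pointwise limit of \<open>Zlim\<close> as \<open>\<theta>\<close> tends to
    infinity along the integers; its measurability is inherited from that limit.\<close>
  define h :: "'a \<Rightarrow> complex" where "h \<omega> = (if U (path \<omega>) = K then 1 else 0)" for \<omega>
  have h_lim: "(\<lambda>j. Zlim (real j) (path \<omega>)) \<longlonglongrightarrow> h \<omega>" for \<omega>
    using vanish[of "U (path \<omega>)"] U_K[of "path \<omega>"] by (auto simp: h_def Zlim_def)
  have h_meas [measurable]: "h \<in> borel_measurable M"
    by (rule borel_measurable_LIMSEQ_metric[OF Zlim_meas h_lim])
  define H where "H = {\<omega> \<in> space M. h \<omega> = 1}"
  have [measurable]: "H \<in> sets M"
    unfolding H_def by measurable
  \<comment> \<open>The time limit was taken first, for fixed \<open>\<theta>\<close>; now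
    \<open>\<theta>\<close> tends to infinity. Both limits pass through the integral by the bound
    \<open>1\<close>.\<close>
  have "(\<integral>\<omega>. indicator (cyl vs0 N) \<omega> *\<^sub>R h \<omega> \<partial>M) = 0"
  proof (rule LIMSEQ_unique)
    show "(\<lambda>j. \<integral>\<omega>. indicator (cyl vs0 N) \<omega> *\<^sub>R Zlim (real j) (path \<omega>) \<partial>M) \<longlonglongrightarrow> (\<integral>\<omega>. indicator (cyl vs0 N) \<omega> *\<^sub>R h \<omega> \<partial>M)"
      by (rule integral_dominated_convergence[where w = "\<lambda>_. 1"])
        (use Zlim_bound in \<open>auto intro!: tendsto_intros h_lim simp: indicator_def\<close>)
    have "used N vs0 = {}"
      by (auto simp: used_def)
    \<comment> \<open>At time \<open>N\<close> nothing has been used, and the empty set is a proper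
      subset of \<open>K\<close>.\<close>
    then have "(\<lambda>j. Z (real j) N vs0) \<longlonglongrightarrow> 0"
      using vanish[of "{}"] K(3) by (auto simp: Z_def)
    then show "(\<lambda>j. \<integral>\<omega>. indicator (cyl vs0 N) \<omega> *\<^sub>R Zlim (real j) (path \<omega>) \<partial>M) \<longlonglongrightarrow> 0"
      unfolding integral_Zlim by (rule tendsto_mult_left_zero)
  qed
  moreover have "(\<integral>\<omega>. indicator (cyl vs0 N) \<omega> *\<^sub>R h \<omega> \<partial>M) = (\<integral>\<omega>. complex_of_real (indicator (cyl vs0 N \<inter> H) \<omega>) \<partial>M)"
    by (rule Bochner_Integration.integral_cong) (simp_all add: h_def H_def indicator_def)
  ultimately have "prob (cyl vs0 N \<inter> H) = 0"
    by simp
  then have "AE \<omega> in M. \<omega> \<notin> cyl vs0 N \<inter> H"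
    using prob_eq_0[of "cyl vs0 N \<inter> H"] by simp
  then show ?thesis
    using AE_space
  proof eventually_elim
    case (elim \<omega>)
    have "U (path \<omega>) = K" if "\<forall>\<kappa>\<in>K. \<exists>n\<ge>N. act n (path \<omega>) \<and> key X0 (path \<omega>) n = \<kappa>"
    proof
      show "K \<subseteq> U (path \<omega>)"
      proof
        fix \<kappa> assume "\<kappa> \<in> K"
        with that obtain n where "N \<le> n" "act n (path \<omega>)" "key X0 (path \<omega>) n = \<kappa>"
          by blast
        with \<open>\<kappa> \<in> K\<close> have "\<kappa> \<in> used (Suc n) (path \<omega>)"
          unfolding used_def by auto
        then show "\<kappa> \<in> U (path \<omega>)"
          unfolding U_def by blast
      qed
    qed (rule U_K)
    then have "\<omega> \<in> H" if "\<forall>\<kappa>\<in>K. \<exists>n\<ge>N. act n (path \<omega>) \<and> key X0 (path \<omega>) n = \<kappa>"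
      using that elim(2) by (simp add: H_def h_def)
    with elim(1) show ?case
      by blast
  qed
qed

end

section \<open>Cuts of the four-cycle and parity of crossings\<close>

definition cycle_edge :: "nat \<Rightarrow> nat set" where
  "cycle_edge i = {i, (i + 1) mod 4}"

lemma nbr4_sym: "nbr4 v w \<longleftrightarrow> nbr4 w v"
  by (auto simp: nbr4_def)

lemma nbr4_cycle_edge: "nbr4 v w \<Longrightarrow> \<exists>i<4. {v, w} = cycle_edge i"
  unfolding nbr4_def cycle_edge_def by (metis insert_commute)

text \<open>Removing two edges disconnects the cycle; \<open>side\<close> indicates the component of \<open>v\<close>.\<close>

lemma edge_cut:
  assumes "i < 4" "j < 4" "i \<noteq> j"
  shows "\<exists>side :: nat \<Rightarrow> bool. side v \<and>
    (\<forall>y z. nbr4 y z \<longrightarrow> {y, z} \<noteq> cycle_edge j \<longrightarrow> (side y \<noteq> side z) = ({y, z} = cycle_edge i))"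
proof -
  \<comment> \<open>Deleting edge \<open>j\<close> leaves a path starting at \<open>j + 1\<close>,
    on which \<open>(y + 3 - j) mod 4\<close> is the position of \<open>y\<close>. Thus
    \<open>S\<close> holds up to and including \<open>i\<close>, and edge \<open>i\<close> is the
    only remaining edge leaving this set.\<close>
  define S where "S y \<longleftrightarrow> (y + 3 - j) mod 4 \<le> (i + 3 - j) mod 4" for y
  have succ: "(S y \<noteq> S ((y + 1) mod 4)) = (cycle_edge y = cycle_edge i)"
    if "y < 4" "cycle_edge y \<noteq> cycle_edge j" for y
    using less_4_cases[OF assms(1)] less_4_cases[OF assms(2)] less_4_cases[OF that(1)] assms(3) that(2)
    by (elim disjE) (simp_all add: S_def cycle_edge_def doubleton_eq_iff)
  have "(S y \<noteq> S z) = ({y, z} = cycle_edge i)" if yz: "nbr4 y z" "{y, z} \<noteq> cycle_edge j" for y z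
  proof -
    consider "z = (y + 1) mod 4" | "y = (z + 1) mod 4"
      using yz(1) by (auto simp: nbr4_def)
    then show ?thesis
    proof cases
      case 1
      then have "{y, z} = cycle_edge y"
        by (simp add: cycle_edge_def)
      then show ?thesis
        using succ[of y] yz 1 nbr4_less(1)[OF yz(1)] by simp
    next
      case 2
      then have "{y, z} = cycle_edge z"
        by (auto simp: cycle_edge_def)
      then show ?thesis
        using succ[of z] yz 2 nbr4_less(2)[OF yz(1)] by auto
    qed
  qed
  then show ?thesis
    by (intro exI[of _ "\<lambda>y. S y = S v"]) auto
qed

text \<open>While \<open>f\<close> is avoided, the walk changes sides exactly when it crosses
  \<open>e\<close>, which also flips the parity of the weight. The sum of the two weights has the
  parity of their difference and avoids natural subtraction.\<close>

lemma side_parity: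
  fixes side :: "nat \<Rightarrow> bool"
  assumes "\<And>y z. nbr4 y z \<Longrightarrow> {y, z} \<noteq> f \<Longrightarrow> (side y \<noteq> side z) = ({y, z} = e)"
    and "N \<le> n"
    and "\<And>k. N \<le> k \<Longrightarrow> k < n \<Longrightarrow> nbr4 (vs k) (vs (Suc k)) \<and> {vs k, vs (Suc k)} \<noteq> f"
  shows "even (cur_weight X0 vs n e + cur_weight X0 vs N e) \<longleftrightarrow> side (vs n) = side (vs N)"
  using assms(2,3)
proof (induction rule: dec_induct)
  case base
  then show ?case by simp
next
  case (step n)
  then have IH: "even (cur_weight X0 vs n e + cur_weight X0 vs N e) \<longleftrightarrow> side (vs n) = side (vs N)"
    by simp
  have "(side (vs n) \<noteq> side (vs (Suc n))) = ({vs n, vs (Suc n)} = e)"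
    using step.prems[of n] step.hyps by (intro assms(1)) auto
  moreover have "even (cur_weight X0 vs (Suc n) e + cur_weight X0 vs N e) \<longleftrightarrow>
      even (cur_weight X0 vs n e + cur_weight X0 vs N e) \<noteq> ({vs n, vs (Suc n)} = e)"
    by (auto simp: cur_weight_Suc)
  ultimately show ?case
    using IH by argo
qed

section \<open>Edges crossed infinitely often\<close>

context errw4
begin

text \<open>Select every step from time \<open>0\<close>. If all four edges were crossed infinitely
  often, every weight from the initial one on would be attained on each, exhausting
  \<open>K\<close>.\<close>

lemma not_all_edges_AE:
  assumes "summable (\<lambda>k. 1 / W k)"
  shows "AE \<omega> in M. \<exists>j<4. \<not> (\<exists>\<^sub>\<infinity>k. {path \<omega> k, path \<omega> (Suc k)} = cycle_edge j)"
proof (rule AE_cylinderwise[of 0])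
  fix vs0
  define K where "K = (SIGMA e : cycle_edge ` {..<4}. {X0 e..})"
  have "AE \<omega> in M. \<omega> \<in> cyl vs0 0 \<longrightarrow>
    \<not> (\<forall>\<kappa>\<in>K. \<exists>n\<ge>0. True \<and> key X0 (path \<omega>) n = \<kappa>)"
  proof (rule exhausted_AE[OF assms, where act = "\<lambda>_ _. True" and E = "cycle_edge ` {..<4}"])
    have "(cycle_edge 0, X0 (cycle_edge 0)) \<in> K"
      by (auto simp: K_def)
    then show "K \<noteq> {}"
      by blast
    fix n vs
    assume "\<And>k. k \<le> n \<Longrightarrow> nbr4 (vs k) (vs (Suc k))"
    then have "\<exists>i<4. {vs n, vs (Suc n)} = cycle_edge i"
      by (intro nbr4_cycle_edge) simp
    then show "key X0 vs n \<in> K"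
      by (auto simp: K_def key_def cur_weight_def)
  qed (auto simp: K_def)
  then show "AE \<omega> in M. \<omega> \<in> cyl vs0 0 \<longrightarrow>
    (\<exists>j<4. \<not> (\<exists>\<^sub>\<infinity>k. {path \<omega> k, path \<omega> (Suc k)} = cycle_edge j))"
  proof eventually_elim
    case (elim \<omega>)
    show ?case
    proof (rule ccontr)
      assume "\<not> ?thesis"
      then have \<omega>: "\<omega> \<in> cyl vs0 0"
        and io: "\<And>j. j < 4 \<Longrightarrow> \<exists>\<^sub>\<infinity>k. {path \<omega> k, path \<omega> (Suc k)} = cycle_edge j"
        by blast+
      have "\<exists>n. key X0 (path \<omega>) n = \<kappa>" if "\<kappa> \<in> K" for \<kappa>
      proof -
        obtain e x where "\<kappa> = (e, x)" "e \<in> cycle_edge ` {..<4}" "X0 e \<le> x"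
          using \<open>\<kappa> \<in> K\<close> by (auto simp: K_def)
        then obtain j where "j < 4" "\<kappa> = (cycle_edge j, x)" "X0 (cycle_edge j) \<le> x"
          by blast
        then show ?thesis
          using weight_attained[OF io[of j], of X0 0 x] by (simp add: cur_weight_def)
      qed
      with elim \<omega> show False
        by simp
    qed
  qed
qed

text \<open>Once edge \<open>j\<close> is avoided, the parity of a weight determines the direction
  of the crossing. The pairs used by departures from \<open>v\<close> are therefore already
  determined by the history up to \<open>N\<close>.\<close>

lemma not_both_edges_after:
  assumes summ: "summable (\<lambda>k. 1 / W k)"
    and ab: "nbr4 v a" "nbr4 v b" "a \<noteq> b" and "j < 4"
  shows "AE \<omega> in M. (\<forall>k\<ge>N. {path \<omega> k, path \<omega> (Suc k)} \<noteq> cycle_edge j) \<longrightarrow>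
    \<not> ((\<exists>\<^sub>\<infinity>k. {path \<omega> k, path \<omega> (Suc k)} = {v, a}) \<and> (\<exists>\<^sub>\<infinity>k. {path \<omega> k, path \<omega> (Suc k)} = {v, b}))"
proof (cases "cycle_edge j = {v, a} \<or> cycle_edge j = {v, b}")
  case True
  then show ?thesis
    unfolding INFM_nat_le by (intro AE_I2) metis
next
  case False
  define f where "f = cycle_edge j"
  define E where "E = {{v, a}, {v, b}}"
  have E_nbr: "{v, w} \<in> E" if w: "nbr4 v w" for w
  proof -
    obtain a' b' where "{w. nbr4 v w} = {a', b'}"
      using nbr4_cases[OF nbr4_less(1)[OF w]] .
    then have "w = a \<or> w = b"
      using w ab by (metis insertE mem_Collect_eq singletonD)
    then show ?thesis
      by (auto simp: E_def)
  qed
  have f_E: "f \<notin> E"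
    using False by (auto simp: E_def f_def)
  have "\<forall>e\<in>E. \<exists>s. s v \<and> (\<forall>y z. nbr4 y z \<longrightarrow> {y, z} \<noteq> f \<longrightarrow> (s y \<noteq> s z) = ({y, z} = e))"
  proof
    fix e assume "e \<in> E"
    then obtain i where "i < 4" "e = cycle_edge i"
      using nbr4_cycle_edge ab unfolding E_def by blast
    moreover from this have "i \<noteq> j"
      using f_E \<open>e \<in> E\<close> by (auto simp: f_def)
    ultimately show "\<exists>s. s v \<and> (\<forall>y z. nbr4 y z \<longrightarrow> {y, z} \<noteq> f \<longrightarrow> (s y \<noteq> s z) = ({y, z} = e))"
      unfolding f_def using edge_cut[of i j v] \<open>j < 4\<close> by simp
  qed
  from bchoice[OF this] obtain side where sides: "\<forall>e\<in>E. side e v \<and>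
      (\<forall>y z. nbr4 y z \<longrightarrow> {y, z} \<noteq> f \<longrightarrow> (side e y \<noteq> side e z) = ({y, z} = e))"
    by (elim exE)
  have side_v: "side e v" if "e \<in> E" for e
    using sides that by simp
  have side: "(side e y \<noteq> side e z) = ({y, z} = e)" if "e \<in> E" "nbr4 y z" "{y, z} \<noteq> f" for e y z
    using bspec[OF sides \<open>e \<in> E\<close>] that(2,3) by simp
  show ?thesis
    unfolding f_def[symmetric]
  proof (rule AE_cylinderwise[of N])
    fix vs0
    define x0 where "x0 e = cur_weight X0 vs0 N e" for e
    \<comment> \<open>the weights at which \<open>e\<close> is crossed from \<open>v\<close>, as long as \<open>f\<close> is avoided\<close>
    define K where "K = {(e, x). e \<in> E \<and> x0 e \<le> x \<and> even (x + x0 e) = side e (vs0 N)}"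
    \<comment> \<open>Selection stops as soon as \<open>f\<close> is crossed. Hence the selected
      pairs lie in \<open>K\<close> on all continuations of the history, and not only on those
      avoiding \<open>f\<close>.\<close>
    define act where "act n vs \<longleftrightarrow> vs n = v \<and> (\<forall>k. N \<le> k \<and> k < n \<longrightarrow> {vs k, vs (Suc k)} \<noteq> f)"
      for n and vs :: "nat \<Rightarrow> nat"
    have parity: "even (cur_weight X0 vs n e + x0 e) \<longleftrightarrow> side e (vs n) = side e (vs0 N)"
      if "e \<in> E" "N \<le> n" "\<And>k. k \<le> N \<Longrightarrow> vs k = vs0 k" "\<And>k. k < n \<Longrightarrow> nbr4 (vs k) (vs (Suc k))"
        "\<And>k. N \<le> k \<Longrightarrow> k < n \<Longrightarrow> {vs k, vs (Suc k)} \<noteq> f" for vs n e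
    proof -
      have "cur_weight X0 vs N e = x0 e"
        unfolding x0_def using that(3) by (rule cur_weight_cong)
      then show ?thesis
        using side_parity[of f "side e" e N n vs X0] side[OF \<open>e \<in> E\<close>] that by simp
    qed
    have "AE \<omega> in M. \<omega> \<in> cyl vs0 N \<longrightarrow>
      \<not> (\<forall>\<kappa>\<in>K. \<exists>n\<ge>N. act n (path \<omega>) \<and> key X0 (path \<omega>) n = \<kappa>)"
    proof (rule exhausted_AE[OF summ, where E = E])
      show "finite E"
        by (simp add: E_def)
      show "K \<subseteq> E \<times> UNIV"
        by (auto simp: K_def)
      \<comment> \<open>The least weight from \<open>x0 {v, a}\<close> on with the parity prescribed
        by \<open>K\<close>.\<close>
      have "({v, a}, if side {v, a} (vs0 N) then x0 {v, a} else Suc (x0 {v, a})) \<in> K"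
        by (auto simp: K_def E_def)
      then show "K \<noteq> {}"
        by blast
    next
      fix n and vs vs' :: "nat \<Rightarrow> nat"
      assume "\<And>k. k \<le> n \<Longrightarrow> vs k = vs' k"
      then show "act n vs = act n vs'"
        by (auto simp: act_def Suc_le_eq)
    next
      fix n vs
      assume n: "N \<le> n" and vs0: "\<And>k. k \<le> N \<Longrightarrow> vs k = vs0 k"
        and nbr: "\<And>k. k \<le> n \<Longrightarrow> nbr4 (vs k) (vs (Suc k))" and act: "act n vs"
      define e where "e = {vs n, vs (Suc n)}"
      have e: "e \<in> E"
        using nbr[of n] act E_nbr by (simp add: e_def act_def)
      have "even (cur_weight X0 vs n e + x0 e) \<longleftrightarrow> side e (vs n) = side e (vs0 N)"
        using e n vs0 nbr act by (intro parity) (auto simp: act_def)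
      moreover have "side e (vs n)"
        using side_v[OF e] act by (simp add: act_def)
      moreover have "x0 e \<le> cur_weight X0 vs n e"
        using cur_weight_mono[OF n, of X0 vs e] cur_weight_cong[of N vs vs0 X0 e] vs0 by (simp add: x0_def)
      ultimately show "key X0 vs n \<in> K"
        using e by (simp add: K_def key_def e_def)
    qed
    then show "AE \<omega> in M. \<omega> \<in> cyl vs0 N \<longrightarrow> (\<forall>k\<ge>N. {path \<omega> k, path \<omega> (Suc k)} \<noteq> f) \<longrightarrow>
      \<not> ((\<exists>\<^sub>\<infinity>k. {path \<omega> k, path \<omega> (Suc k)} = {v, a}) \<and> (\<exists>\<^sub>\<infinity>k. {path \<omega> k, path \<omega> (Suc k)} = {v, b}))"
      using AE_nbr4
    proof eventually_elim
      case (elim \<omega>)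
      show ?case
      proof (intro impI notI)
        assume \<omega>: "\<omega> \<in> cyl vs0 N" and no_f: "\<forall>k\<ge>N. {path \<omega> k, path \<omega> (Suc k)} \<noteq> f"
          and "(\<exists>\<^sub>\<infinity>k. {path \<omega> k, path \<omega> (Suc k)} = {v, a}) \<and> (\<exists>\<^sub>\<infinity>k. {path \<omega> k, path \<omega> (Suc k)} = {v, b})"
        then have io: "\<exists>\<^sub>\<infinity>k. {path \<omega> k, path \<omega> (Suc k)} = e" if "e \<in> E" for e
          using that by (auto simp: E_def)
        have nbr: "nbr4 (path \<omega> k) (path \<omega> (Suc k))" for k
          using elim(2) by (simp add: path_def)
        have vs0: "path \<omega> k = vs0 k" if "k \<le> N" for k
          using \<omega> that by (simp add: cyl_def path_def)
        have "\<exists>n\<ge>N. act n (path \<omega>) \<and> key X0 (path \<omega>) n = \<kappa>" if "\<kappa> \<in> K" for \<kappa>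
        proof -
          obtain e x where \<kappa>: "\<kappa> = (e, x)" and e: "e \<in> E" and x: "x0 e \<le> x" "even (x + x0 e) = side e (vs0 N)"
            using \<open>\<kappa> \<in> K\<close> by (auto simp: K_def)
          have "cur_weight X0 (path \<omega>) N e = x0 e"
            unfolding x0_def using vs0 by (rule cur_weight_cong)
          then obtain n where n: "n \<ge> N" "key X0 (path \<omega>) n = (e, x)"
            using weight_attained[OF io[OF e], of X0 N x] x(1) by auto
          then have crossing: "{path \<omega> n, path \<omega> (Suc n)} = e" "cur_weight X0 (path \<omega>) n e = x"
            by (auto simp: key_def)
          \<comment> \<open>The parity of \<open>x\<close> forces this crossing to start on the side
            of \<open>v\<close>. As it changes sides and \<open>v\<close> is one of its endpoints,
            it starts at \<open>v\<close>.\<close>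
          have "even (x + x0 e) \<longleftrightarrow> side e (path \<omega> n) = side e (vs0 N)"
            using parity[OF e n(1) vs0 nbr] no_f crossing(2) by simp
          with x(2) have "side e (path \<omega> n)"
            by auto
          moreover have "side e (path \<omega> n) \<noteq> side e (path \<omega> (Suc n))"
            using side[OF e nbr] no_f n(1) crossing(1) by blast
          moreover have "v = path \<omega> n \<or> v = path \<omega> (Suc n)"
            using e crossing(1) unfolding E_def by blast
          ultimately have "path \<omega> n = v"
            using side_v[OF e] by auto
          then have "act n (path \<omega>)"
            using no_f by (simp add: act_def)
          with n \<kappa> show ?thesis
            by blast
        qed
        with elim(1) \<omega> show False
          by blast
      qed
    qed
  qed
qed

lemma eventually_single_edge_AE:
  assumes summ: "summable (\<lambda>k. 1 / W k)"
  shows "AE \<omega> in M. \<exists>n. \<forall>k\<ge>n.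
    {path \<omega> k, path \<omega> (Suc k)} = {path \<omega> (Suc k), path \<omega> (Suc (Suc k))}"
proof -
  \<comment> \<open>All five parameters are naturals, so one null set serves for all of them,
    including the random \<open>j\<close> and \<open>N\<close> chosen below.\<close>
  have "AE \<omega> in M. \<forall>v a b j N. nbr4 v a \<longrightarrow> nbr4 v b \<longrightarrow> a \<noteq> b \<longrightarrow> j < 4 \<longrightarrow>
      (\<forall>k\<ge>N. {path \<omega> k, path \<omega> (Suc k)} \<noteq> cycle_edge j) \<longrightarrow>
      \<not> ((\<exists>\<^sub>\<infinity>k. {path \<omega> k, path \<omega> (Suc k)} = {v, a}) \<and> (\<exists>\<^sub>\<infinity>k. {path \<omega> k, path \<omega> (Suc k)} = {v, b}))"
    unfolding AE_all_countable using not_both_edges_after[OF summ] by auto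
  with not_all_edges_AE[OF summ] AE_nbr4 show ?thesis
  proof eventually_elim
    case (elim \<omega>)
    let ?e = "\<lambda>k. {path \<omega> k, path \<omega> (Suc k)}"
    have nbr: "nbr4 (path \<omega> k) (path \<omega> (Suc k))" for k
      using elim(2) by (simp add: path_def)
    obtain j where j: "j < 4" "\<not> (\<exists>\<^sub>\<infinity>k. ?e k = cycle_edge j)"
      using elim(1) by blast
    then obtain N where N: "\<forall>k\<ge>N. ?e k \<noteq> cycle_edge j"
      unfolding INFM_nat_le by blast
    have not_both: "\<not> ((\<exists>\<^sub>\<infinity>k. ?e k = {v, a}) \<and> (\<exists>\<^sub>\<infinity>k. ?e k = {v, b}))" if "nbr4 v a" "nbr4 v b" "a \<noteq> b" for v a b
      using elim(3) that j(1) N by blast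
    \<comment> \<open>With finitely many edges, from some time on only edges crossed infinitely
      often are still crossed.\<close>
    have "\<forall>i\<in>{..<4}. eventually (\<lambda>k. ?e k = cycle_edge i \<longrightarrow> (\<exists>\<^sub>\<infinity>l. ?e l = cycle_edge i)) sequentially"
    proof
      fix i :: nat
      show "eventually (\<lambda>k. ?e k = cycle_edge i \<longrightarrow> (\<exists>\<^sub>\<infinity>l. ?e l = cycle_edge i)) sequentially"
      proof (cases "\<exists>\<^sub>\<infinity>l. ?e l = cycle_edge i")
        case False
        then have "eventually (\<lambda>k. ?e k \<noteq> cycle_edge i) sequentially"
          by (simp add: not_frequently cofinite_eq_sequentially)
        then show ?thesis
          by (rule eventually_mono) simp
      qed simp
    qed
    then have "eventually (\<lambda>k. \<forall>i\<in>{..<4}. ?e k = cycle_edge i \<longrightarrow> (\<exists>\<^sub>\<infinity>l. ?e l = cycle_edge i)) sequentially"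
      by (intro eventually_ball_finite) simp_all
    then obtain n where n: "\<And>k i. k \<ge> n \<Longrightarrow> i < 4 \<Longrightarrow> ?e k = cycle_edge i \<Longrightarrow> \<exists>\<^sub>\<infinity>l. ?e l = cycle_edge i"
      unfolding eventually_sequentially by blast
    have io: "\<exists>\<^sub>\<infinity>l. ?e l = ?e k" if "k \<ge> n" for k
      using nbr4_cycle_edge[OF nbr[of k]] n[OF that] by metis
    \<comment> \<open>Two different consecutive edges would share the vertex
      \<open>path \<omega> (Suc k)\<close> and both be crossed infinitely often.\<close>
    have "?e k = ?e (Suc k)" if "k \<ge> n" for k
    proof (rule ccontr)
      assume "?e k \<noteq> ?e (Suc k)"
      then have "path \<omega> k \<noteq> path \<omega> (Suc (Suc k))"
        by (auto simp: insert_commute)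
      moreover have "\<exists>\<^sub>\<infinity>l. ?e l = {path \<omega> (Suc k), path \<omega> k}"
        using io[OF that] by (simp add: insert_commute)
      moreover have "\<exists>\<^sub>\<infinity>l. ?e l = {path \<omega> (Suc k), path \<omega> (Suc (Suc k))}"
        using io[of "Suc k"] that by simp
      moreover have "nbr4 (path \<omega> (Suc k)) (path \<omega> k)" "nbr4 (path \<omega> (Suc k)) (path \<omega> (Suc (Suc k)))"
        using nbr nbr4_sym by blast+
      ultimately show False
        using not_both by blast
    qed
    then show ?case
      by blast
  qed
qed

end

theorem theorem2:
  fixes M :: "'a measure" and I :: "nat \<Rightarrow> 'a \<Rightarrow> nat"
    and W :: "nat \<Rightarrow> real" and X0 :: "nat set \<Rightarrow> nat" and v0 :: nat
  assumes "\<And>k. W k > 0"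
    and "v0 < 4"
    and "summable (\<lambda>k. 1 / W k)"
    and "is_errw4 M I W X0 v0"
  shows "measure M {\<omega> \<in> space M. \<exists>n. \<forall>k\<ge>n.
            {I k \<omega>, I (Suc k) \<omega>} = {I (Suc k) \<omega>, I (Suc (Suc k)) \<omega>}} = 1"
proof -
  interpret prob_space M
    using assms(4) by (simp add: is_errw4_def)
  interpret errw4 M I W X0 v0
    using assms(1,4) by unfold_locales (simp_all add: is_errw4_def)
  \<comment> \<open>Each condition involves three positions only; countable quantifiers then make
    the event measurable, as passing from almost sure validity to probability \<open>1\<close>
    requires.\<close>
  have [measurable]: "Measurable.pred M (\<lambda>\<omega>. {path \<omega> k, path \<omega> (Suc k)} = {path \<omega> (Suc k), path \<omega> (Suc (Suc k))})" for k
    by (rule finite_dependence_measurable[of "Suc (Suc k)"]) simp_all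
  have "prob {\<omega> \<in> space M. \<exists>n. \<forall>k\<ge>n.
      {path \<omega> k, path \<omega> (Suc k)} = {path \<omega> (Suc k), path \<omega> (Suc (Suc k))}} = 1"
    using eventually_single_edge_AE[OF assms(3)] by (subst prob_Collect_eq_1) measurable
  then show ?thesis
    by (simp add: path_def)
qed

end
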